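(* Let $\mu > 0$ be a real number. There is exactly one retraction map $b_\mu : \mathbb{R} \to \mathbb{R}_+$ with parameter $\mu$ (in the sense defined in the context), namely the softplus function $$b_\mu(v) = \frac{v + \sqrt{v^2 + 4\mu}}{2}, \qquad v \in \mathbb{R}.$$ That is, this function is a retraction map with parameter $\mu$, and every retraction map with parameter $\mu$ is equal to it.
   Context: $\mathbb{R}_+$ denotes the set of strictly positive real numbers. For $\mu>0$, a differentiable function $b_\mu : \mathbb{R} \to \mathbb{R}_+$ is called a retraction map (with parameter $\mu$) if, for all $v \in \mathbb{R}$, the following three properties hold: (1) $b_\mu(v) \cdot b_\mu(-v) = \mu$; (2) $db_\mu(v) + db_\mu(-v) = 1$; (3) $0 < db_\mu(v) \le 1$. Here $db_\mu$ denotes the derivative of $b_\mu$ with respect to its argument, so $db_\mu(-v)$ is the derivative of $b_\mu$ evaluated at the point $-v$. *)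

theory Defs
  imports "HOL-Analysis.Analysis"
begin

(* The codomain of strictly positive reals is rendered by the positivity conjunct.
   deriv b (- v) is the derivative of b evaluated at - v, not that of w |-> b (- w) at v. *)
definition is_retraction_map :: "real \<Rightarrow> (real \<Rightarrow> real) \<Rightarrow> bool" where
  "is_retraction_map \<mu> b \<longleftrightarrow>
     (\<forall>v. b v > 0) \<and>
     (\<forall>v. b differentiable (at v)) \<and>
     (\<forall>v. b v * b (- v) = \<mu>) \<and>
     (\<forall>v. deriv b v + deriv b (- v) = 1) \<and>
     (\<forall>v. 0 < deriv b v \<and> deriv b v \<le> 1)"

definition softplus :: "real \<Rightarrow> real \<Rightarrow> real" where
  "softplus \<mu> v = (v + sqrt (v\<^sup>2 + 4 * \<mu>)) / 2"

end

(* By (2), the derivative of b v - b (- v) - v vanishes identically, so b v - b (- v) = v.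
   With (1), (b v + b (- v))^2 = v^2 + 4 mu, and the sum and difference determine b v. *)
theory Submission
  imports Defs
begin

text \<open>Uniqueness: property (2) fixes the odd part of \<open>b\<close>
  (\<open>retraction_map_odd_part\<close>). With (1), \<open>b v\<close> and
  \<open>- b (- v)\<close> have sum \<open>v\<close> and product \<open>- \<mu>\<close>, so they are
  the roots of \<open>t^2 - v * t - \<mu>\<close>, and positivity makes \<open>b v\<close> the
  larger one, which is \<open>softplus \<mu> v\<close>. Existence is a direct check; that the square
  root of the discriminant exceeds \<open>\<bar>v\<bar>\<close> gives both positivity and the
  derivative bounds.\<close>

lemma abs_less_sqrt_discriminant:
  fixes v \<mu> :: real
  assumes "\<mu> > 0"
  shows "\<bar>v\<bar> < sqrt (v\<^sup>2 + 4 * \<mu>)"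
  using assms by (intro real_less_rsqrt) simp

lemma softplus_has_real_derivative:
  assumes "\<mu> > 0"
  shows "(softplus \<mu> has_real_derivative (1 + v / sqrt (v\<^sup>2 + 4 * \<mu>)) / 2) (at v)"
proof -
  have "v\<^sup>2 + 4 * \<mu> > 0"
    using assms by (simp add: add_nonneg_pos)
  then show ?thesis
    unfolding softplus_def[abs_def]
    by (auto intro!: derivative_eq_intros simp: field_simps)
qed

lemma is_retraction_map_softplus:
  assumes "\<mu> > 0"
  shows "is_retraction_map \<mu> (softplus \<mu>)"
proof -
  have deriv: "deriv (softplus \<mu>) v = (1 + v / sqrt (v\<^sup>2 + 4 * \<mu>)) / 2" for v
    using softplus_has_real_derivative[OF assms] by (rule DERIV_imp_deriv)
  have "softplus \<mu> v > 0" for v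
    using abs_less_sqrt_discriminant[OF assms, of v] by (simp add: softplus_def)
  moreover have "softplus \<mu> differentiable (at v)" for v
    using softplus_has_real_derivative[OF assms] real_differentiable_def by blast
  moreover have "softplus \<mu> v * softplus \<mu> (- v) = \<mu>" for v
  proof -
    \<comment> \<open>The product is a difference of squares, a quarter of this square minus
      \<open>v^2\<close>.\<close>
    have "(sqrt (v\<^sup>2 + 4 * \<mu>))\<^sup>2 = v\<^sup>2 + 4 * \<mu>"
      using assms by simp
    then show ?thesis
      by (simp add: softplus_def field_simps power2_eq_square)
  qed
  moreover have "deriv (softplus \<mu>) v + deriv (softplus \<mu>) (- v) = 1" for v
    \<comment> \<open>The quotient of \<open>v\<close> by the root is odd in \<open>v\<close>, so it
      cancels.\<close>
    by (simp add: deriv field_simps)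
  moreover have "0 < deriv (softplus \<mu>) v \<and> deriv (softplus \<mu>) v \<le> 1" for v
  proof -
    have "\<bar>v / sqrt (v\<^sup>2 + 4 * \<mu>)\<bar> < 1"
      using abs_less_sqrt_discriminant[OF assms, of v] by (auto simp: abs_divide divide_less_eq)
    then show ?thesis
      by (auto simp: deriv abs_less_iff simp del: abs_divide)
  qed
  ultimately show ?thesis
    unfolding is_retraction_map_def by blast
qed

lemma retraction_map_odd_part:
  assumes "is_retraction_map \<mu> b"
  shows "b v - b (- v) = v"
proof -
  have D: "(b has_real_derivative deriv b x) (at x)" for x
    using assms by (simp add: is_retraction_map_def DERIV_deriv_iff_real_differentiable)
  have "((\<lambda>x. b x - b (- x) - x) has_real_derivative 0) (at x)" for x
  proof -
    \<comment> \<open>The sign from the chain rule turns the difference into the sum of derivatives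
      in (2).\<close>
    have "((\<lambda>x. b (- x)) has_real_derivative deriv b (- x) * (- 1)) (at x)"
      by (rule DERIV_chain2[OF D]) (auto intro!: derivative_eq_intros)
    from DERIV_diff[OF DERIV_diff[OF D this] DERIV_ident] show ?thesis
      using assms by (simp add: is_retraction_map_def)
  qed
  \<comment> \<open>Evaluation at 0, where the expression vanishes, fixes the constant.\<close>
  then have "b v - b (- v) - v = b 0 - b (- 0) - 0"
    by (intro DERIV_isconst_all) auto
  then show ?thesis by simp
qed

lemma retraction_map_eq_softplus:
  assumes "is_retraction_map \<mu> b"
  shows "b = softplus \<mu>"
proof
  fix v
  have pos: "b v > 0" "b (- v) > 0" and prod: "b v * b (- v) = \<mu>"
    using assms by (auto simp: is_retraction_map_def)
  have diff: "b v - b (- v) = v"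
    by (rule retraction_map_odd_part[OF assms])
  have "v\<^sup>2 + 4 * \<mu> = (b v - b (- v))\<^sup>2 + 4 * (b v * b (- v))"
    by (simp only: diff prod)
  also have "\<dots> = (b v + b (- v))\<^sup>2"
    by (simp add: power2_eq_square algebra_simps)
  \<comment> \<open>Positivity of \<open>b\<close> selects the sum itself rather than its
    negative.\<close>
  finally have "sqrt (v\<^sup>2 + 4 * \<mu>) = b v + b (- v)"
    using pos by simp
  then show "b v = softplus \<mu> v"
    using diff by (simp add: softplus_def)
qed

theorem theorem1:
  fixes \<mu> :: real
  assumes "\<mu> > 0"
  shows "is_retraction_map \<mu> (softplus \<mu>) \<and>
         (\<forall>b. is_retraction_map \<mu> b \<longrightarrow> b = softplus \<mu>)"
  using assms is_retraction_map_softplus retraction_map_eq_softplus by blast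

end
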